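(* (1) Let $a\le b\le c-1$ be positive integers. Then, for any prime number $p$ such that $b+c\le p^n\le a+b+c-1$ for some integer $n\ge1$, we have $p\mid M(a,b,c)$. (2) Let $a\le b$ be positive integers. Then, for any prime number $p$ such that $2b\le p^n\le a+2b-2$ for some integer $n\ge1$, we have $p\mid M(a,b,b)$.
   Context: For integers $a,b,c\ge1$, $$M(a,b,c)=\prod_{i=1}^a\prod_{j=1}^b\prod_{k=1}^c\frac{i+j+k-1}{i+j+k-2}=\prod_{i=1}^a\frac{(b+c+i-1)!\,(i-1)!}{(b+i-1)!\,(c+i-1)!},$$ which is a positive integer (the number of plane partitions contained inside an $a\times b\times c$ box). *)

theory Defs
  imports Complex_Main "HOL-Computational_Algebra.Primes"
begin

text \<open>
  The product is taken in the rationals, since its individual factors are not integers.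
  Beware that divisibility in the field of rationals is trivial, so divisibility statements
  about this number have to refer to the natural number it equals.
  All indices are at least 1, so \<open>i + j + k - 2\<close> is a true, positive difference.
\<close>

definition M :: "nat \<Rightarrow> nat \<Rightarrow> nat \<Rightarrow> rat" where
  "M a b c = (\<Prod>i=1..a. \<Prod>j=1..b. \<Prod>k=1..c. of_nat (i + j + k - 1) / of_nat (i + j + k - 2))"

lemma M_inner:
  assumes "1 \<le> i" "1 \<le> j"
  shows "(\<Prod>k=1..c. of_nat (i + j + k - 1) / of_nat (i + j + k - 2) :: rat)
       = of_nat (i + j + c - 1) / of_nat (i + j - 1)"
proof (induction c)
  case 0
  show ?case using assms by simp
next
  case (Suc c)
  obtain t where t: "i + j + c - 1 = Suc t" "i + j + Suc c - 2 = Suc t"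
    using assms by (intro that[of "i + j + c - 2"]) auto
  have "(\<Prod>k=1..Suc c. of_nat (i + j + k - 1) / of_nat (i + j + k - 2) :: rat)
      = of_nat (i + j + c - 1) / of_nat (i + j - 1)
        * (of_nat (i + j + Suc c - 1) / of_nat (i + j + Suc c - 2))"
    using Suc.IH by (subst prod.nat_ivl_Suc') (auto simp: mult.commute)
  then show ?case unfolding t by (simp del: of_nat_Suc)
qed

lemma M_middle:
  assumes "1 \<le> i"
  shows "(\<Prod>j=1..b. of_nat (i + j + c - 1) / of_nat (i + j - 1) :: rat)
       = fact (b + c + i - 1) * fact (i - 1) / (fact (b + i - 1) * fact (c + i - 1))"
proof (induction b)
  case (Suc b)
  obtain h where i: "i = Suc h" using assms by (cases i) auto
  have "(\<Prod>j=1..Suc b. of_nat (i + j + c - 1) / of_nat (i + j - 1) :: rat)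
      = fact (b + c + i - 1) * fact (i - 1) / (fact (b + i - 1) * fact (c + i - 1))
        * (of_nat (i + Suc b + c - 1) / of_nat (i + Suc b - 1))"
    using Suc.IH by (subst prod.nat_ivl_Suc') (auto simp: mult.commute)
  also have "\<dots> = fact (Suc b + c + i - 1) * fact (i - 1) / (fact (Suc b + i - 1) * fact (c + i - 1))"
    unfolding i by (simp add: add_ac mult_ac del: of_nat_Suc of_nat_add)
  finally show ?case .
qed simp

lemma M_eq_fact:
  "M a b c = (\<Prod>i=1..a. fact (b + c + i - 1) * fact (i - 1) / (fact (b + i - 1) * fact (c + i - 1)))"
  unfolding M_def
proof (rule prod.cong[OF refl])
  fix i assume i: "i \<in> {1..a}"
  have "(\<Prod>j=1..b. \<Prod>k=1..c. of_nat (i + j + k - 1) / of_nat (i + j + k - 2) :: rat)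
      = (\<Prod>j=1..b. of_nat (i + j + c - 1) / of_nat (i + j - 1))"
    using i by (intro prod.cong[OF refl] M_inner) auto
  also have "\<dots> = fact (b + c + i - 1) * fact (i - 1) / (fact (b + i - 1) * fact (c + i - 1))"
    using i by (intro M_middle) auto
  finally show "(\<Prod>j=1..b. \<Prod>k=1..c. of_nat (i + j + k - 1) / of_nat (i + j + k - 2) :: rat)
      = fact (b + c + i - 1) * fact (i - 1) / (fact (b + i - 1) * fact (c + i - 1))" .
qed

end

theory Submission imports Defs begin

text \<open>
  Write \<open>M a b c = A / B\<close> with \<open>A = \<Prod>i<a. (b + c + i)! i!\<close> and \<open>B = \<Prod>i<a. (b + i)! (c + i)!\<close>.
  By Legendre's formula, the exponent of a prime \<open>p\<close> in \<open>A\<close> minus its exponent in \<open>B\<close> is the sum,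
  over the powers \<open>q = p ^ e\<close> with \<open>e \<ge> 1\<close>, of a \<^emph>\<open>defect\<close>
  \<open>\<Sum>i<a. \<lfloor>(b+c+i)/q\<rfloor> + \<lfloor>i/q\<rfloor> - \<lfloor>(b+i)/q\<rfloor> - \<lfloor>(c+i)/q\<rfloor>\<close>.

  Every defect is nonnegative (\<open>defect_nonneg\<close>). With \<open>G m = \<Sum>x<m. \<lfloor>x/q\<rfloor>\<close> the defect equals
  \<open>G (a+b+c) + G a + G b + G c - G (a+b) - G (b+c) - G (a+c)\<close>. In this form it is symmetric in
  \<open>a, b, c\<close>, and since \<open>G (q + m) = G m + m\<close> it is periodic with period \<open>q\<close> in each argument. For
  arguments below \<open>q\<close> only values \<open>G m\<close> with \<open>m \<le> 3 q\<close> occur, and there \<open>G\<close> is the sum of the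
  positive parts of \<open>m - q\<close> and \<open>m - 2 q\<close>, so a linear case distinction finishes.
  Hence \<open>M a b c\<close> is an integer.

  If in addition a power \<open>q = p ^ n\<close> satisfies \<open>b + c \<le> q < a + b + c\<close> and \<open>a \<le> b, c\<close>, then in the
  defect at \<open>q\<close> the three floors other than \<open>\<lfloor>(b+c+i)/q\<rfloor>\<close> vanish for all \<open>i < a\<close>, while the
  term \<open>i = a - 1\<close> of the remaining one is at least 1. So this defect is positive, and \<open>p\<close> divides the
  integer \<open>M a b c\<close>. Both parts of the theorem are instances.
\<close>

section \<open>Legendre's formula\<close>

text \<open>
  The exponents \<open>e \<ge> 1\<close> with \<open>p ^ e dvd n\<close> are those up to the multiplicity, and they are below \<open>n\<close>
  because \<open>e < p ^ e \<le> n\<close>. The cutoff \<open>N\<close> is left free so that the same one can serve for several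
  factorials at once.
\<close>
lemma multiplicity_eq_sum_dvd:
  fixes p n N :: nat
  assumes "prime p" "0 < n" "n \<le> N"
  shows "multiplicity p n = (\<Sum>e=1..N. if p ^ e dvd n then 1 else 0)"
proof -
  have p: "1 < p" using assms(1) by (rule prime_gt_1_nat)
  have "multiplicity p n < p ^ multiplicity p n"
    using p by (intro power_gt_expt) simp
  also have "p ^ multiplicity p n \<le> n"
    using assms(2) by (intro dvd_imp_le multiplicity_dvd)
  finally have le: "multiplicity p n \<le> N" using assms(3) by simp
  have "p ^ e dvd n \<longleftrightarrow> e \<le> multiplicity p n" for e
    using p assms(2) by (intro power_dvd_iff_le_multiplicity) auto
  then have "(\<Sum>e=1..N. if p ^ e dvd n then 1 else 0)
      = card ({1..N} \<inter> {e. e \<le> multiplicity p n})"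
    by (simp add: sum.If_cases)
  also have "{1..N} \<inter> {e. e \<le> multiplicity p n} = {1..multiplicity p n}"
    using le by auto
  finally show ?thesis by simp
qed

lemma multiplicity_fact:
  fixes p m N :: nat
  assumes "prime p" "m \<le> N"
  shows "multiplicity p (fact m :: nat) = (\<Sum>e=1..N. m div p ^ e)"
  using assms(2)
proof (induction m)
  case 0
  then show ?case by simp
next
  case (Suc m)
  have "multiplicity p (fact (Suc m) :: nat) = multiplicity p (Suc m) + multiplicity p (fact m :: nat)"
    using assms(1) by (simp add: prime_elem_multiplicity_mult_distrib del: mult_Suc)
  also have "\<dots> = (\<Sum>e=1..N. (if p ^ e dvd Suc m then 1 else 0) + m div p ^ e)"
    using Suc assms(1) by (simp add: multiplicity_eq_sum_dvd[of p "Suc m" N] sum.distrib)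
  also have "\<dots> = (\<Sum>e=1..N. Suc m div p ^ e)"
    by (intro sum.cong refl) (simp add: div_Suc mod_eq_0_iff_dvd)
  finally show ?case .
qed

section \<open>Nonnegativity of the defect\<close>

definition floor_sum :: "nat \<Rightarrow> nat \<Rightarrow> int" where
  "floor_sum q m = (\<Sum>x<m. int (x div q))"

lemma floor_sum_add_period:
  assumes "0 < q"
  shows "floor_sum q (q + m) = floor_sum q m + int m"
proof (induction m)
  case 0
  then show ?case by (simp add: floor_sum_def)
next
  case (Suc m)
  then show ?case using assms by (simp add: floor_sum_def)
qed

lemma floor_sum_eq_0: "m \<le> q \<Longrightarrow> floor_sum q m = 0"
  by (simp add: floor_sum_def)

lemma floor_sum_upto_triple:
  assumes "0 < q" "m \<le> 3 * q"
  shows "floor_sum q m = max 0 (int m - int q) + max 0 (int m - 2 * int q)"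
proof -
  consider "m \<le> q" | l where "m = q + l" "l \<le> q" | l where "m = q + (q + l)" "l \<le> q"
  proof (cases "m \<le> q"; cases "m \<le> 2 * q")
    assume "\<not> m \<le> q" "m \<le> 2 * q"
    then show thesis using that(2)[of "m - q"] by simp
  next
    assume "\<not> m \<le> q" "\<not> m \<le> 2 * q"
    then have "m = q + (q + (m - 2 * q))" "m - 2 * q \<le> q"
      using assms(2) by linarith+
    then show thesis by (rule that(3))
  qed (use that in auto)
  then show ?thesis
    using assms(1) by cases (simp_all add: floor_sum_add_period floor_sum_eq_0)
qed

lemma sum_floor_shift:
  "(\<Sum>i<a. int ((t + i) div q)) = floor_sum q (a + t) - floor_sum q t"
proof (induction a)
  case (Suc a)
  then show ?case by (simp add: floor_sum_def add.commute)
qed simp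

definition defect :: "nat \<Rightarrow> nat \<Rightarrow> nat \<Rightarrow> nat \<Rightarrow> int" where
  "defect q a b c = floor_sum q (a + b + c) + floor_sum q a + floor_sum q b + floor_sum q c
     - floor_sum q (a + b) - floor_sum q (b + c) - floor_sum q (a + c)"

lemma defect_eq_sum:
  "defect q a b c = (\<Sum>i<a. int ((b + c + i) div q) + int (i div q))
     - (\<Sum>i<a. int ((b + i) div q) + int ((c + i) div q))"
  using sum_floor_shift[of "b + c" q a] sum_floor_shift[of b q a]
    sum_floor_shift[of c q a] sum_floor_shift[of 0 q a]
  by (simp add: sum.distrib defect_def add_ac floor_sum_eq_0)

lemma defect_rotate: "defect q a b c = defect q b c a"
  by (simp add: defect_def add_ac)

text \<open>
  Increasing \<open>a\<close> by \<open>q\<close> changes the four values of \<open>floor_sum\<close> that involve \<open>a\<close> by their arguments,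
  and \<open>(a + b + c) + a - (a + b) - (a + c) = 0\<close>.
\<close>
lemma defect_add_period:
  assumes "0 < q"
  shows "defect q (q + a) b c = defect q a b c"
  using assms floor_sum_add_period[of q "a + b + c"] floor_sum_add_period[of q "a + b"]
    floor_sum_add_period[of q "a + c"] floor_sum_add_period[of q a]
  by (simp add: defect_def add_ac)

lemma defect_mod:
  assumes "0 < q"
  shows "defect q (a mod q) b c = defect q a b c"
proof -
  have "defect q (k * q + r) b c = defect q r b c" for k r
    using assms by (induction k) (simp_all add: defect_add_period add.assoc)
  from this[of "a div q" "a mod q"] show ?thesis by simp
qed

lemma defect_nonneg:
  assumes "0 < q"
  shows "0 \<le> defect q a b c"
proof -
  define x y z where "x = a mod q" "y = b mod q" "z = c mod q"
  have less: "x < q" "y < q" "z < q"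
    using assms by (simp_all add: x_y_z_def)
  have "defect q a b c = defect q x y z"
    using assms unfolding x_y_z_def by (metis defect_mod defect_rotate)
  also have "0 \<le> defect q x y z"
    (* the arguments of floor_sum here are at most x + y + z, which is below 3 q *)
    using less unfolding defect_def by (simp add: floor_sum_upto_triple max_def)
  finally show ?thesis .
qed

text \<open>
  For \<open>i < a\<close> the numbers \<open>b + i\<close> and \<open>c + i\<close> are below \<open>b + c \<le> q\<close>, so nothing is subtracted,
  whereas \<open>b + c + i\<close> reaches \<open>q\<close> at the last index \<open>i = a - 1\<close>.
\<close>
lemma defect_pos:
  assumes "a \<le> b" "a \<le> c" "b + c \<le> q" "q < a + b + c"
  shows "0 < defect q a b c"
proof -
  have "0 < a" "0 < q" using assms by linarith+
  have "(\<Sum>i<a. int ((b + i) div q) + int ((c + i) div q)) = 0"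
    using assms by (intro sum.neutral) auto
  moreover have "0 < (b + c + (a - 1)) div q"
    using assms \<open>0 < a\<close> \<open>0 < q\<close> by (simp add: div_greater_zero_iff)
  then have "0 < (\<Sum>i<a. int ((b + c + i) div q) + int (i div q))"
    using \<open>0 < a\<close> by (intro sum_pos2[of _ "a - 1"]) auto
  ultimately show ?thesis by (simp add: defect_eq_sum)
qed

section \<open>Divisibility of the number of plane partitions\<close>

definition M_num :: "nat \<Rightarrow> nat \<Rightarrow> nat \<Rightarrow> nat" where
  "M_num a b c = (\<Prod>i<a. fact (b + c + i) * fact i)"

definition M_den :: "nat \<Rightarrow> nat \<Rightarrow> nat \<Rightarrow> nat" where
  "M_den a b c = (\<Prod>i<a. fact (b + i) * fact (c + i))"

lemma M_num_pos: "0 < M_num a b c" and M_den_pos: "0 < M_den a b c"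
  by (simp_all add: M_num_def M_den_def prod_pos)

lemma M_eq_num_div_den: "M a b c = of_nat (M_num a b c) / of_nat (M_den a b c)"
proof -
  have "M a b c = (\<Prod>i<a. fact (b + c + i) * fact i / (fact (b + i) * fact (c + i)))"
    unfolding M_eq_fact
    by (rule prod.reindex_bij_witness[of _ Suc "\<lambda>i. i - 1"]) auto
  then show ?thesis
    by (simp add: M_num_def M_den_def prod_dividef)
qed

text \<open>
  The bound \<open>a + b + c\<close> exceeds every number whose factorial occurs, so it is a common cutoff for
  Legendre's formula.
\<close>
lemma multiplicity_M_num_minus_den:
  assumes "prime p"
  shows "int (multiplicity p (M_num a b c)) - int (multiplicity p (M_den a b c))
    = (\<Sum>e=1..a + b + c. defect (p ^ e) a b c)"
proof -
  have mult_prod: "multiplicity p (\<Prod>i<a. fact (f i) * fact (g i) :: nat)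
      = (\<Sum>e=1..a + b + c. \<Sum>i<a. f i div p ^ e + g i div p ^ e)"
    if "\<And>i. i < a \<Longrightarrow> f i \<le> a + b + c" "\<And>i. i < a \<Longrightarrow> g i \<le> a + b + c" for f g
  proof -
    have "multiplicity p (\<Prod>i<a. fact (f i) * fact (g i) :: nat)
        = (\<Sum>i<a. multiplicity p (fact (f i) * fact (g i) :: nat))"
      using assms by (intro prime_elem_multiplicity_prod_distrib) auto
    also have "\<dots> = (\<Sum>i<a. \<Sum>e=1..a + b + c. f i div p ^ e + g i div p ^ e)"
      using assms that
      by (intro sum.cong refl)
        (simp add: prime_elem_multiplicity_mult_distrib multiplicity_fact[where N = "a + b + c"]
          sum.distrib)
    finally show ?thesis by (subst (asm) sum.swap)
  qed
  show ?thesis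
    unfolding M_num_def M_den_def
    by (subst (1 2) mult_prod) (auto simp: defect_eq_sum sum_subtractf)
qed

lemma M_den_dvd_M_num: "M_den a b c dvd M_num a b c"
proof (rule multiplicity_le_imp_dvd)
  fix p :: nat
  assume p: "prime p"
  have "0 \<le> (\<Sum>e=1..a + b + c. defect (p ^ e) a b c)"
    using p by (intro sum_nonneg defect_nonneg) (simp add: prime_gt_0_nat)
  then show "multiplicity p (M_den a b c) \<le> multiplicity p (M_num a b c)"
    using multiplicity_M_num_minus_den[OF p, of a b c] by simp
qed (use M_den_pos in simp)

lemma prime_dvd_M:
  fixes a b c p n :: nat
  assumes p: "prime p" and n: "1 \<le> n" and le: "a \<le> b" "a \<le> c"
    and q: "b + c \<le> p ^ n" "p ^ n < a + b + c"
  shows "\<exists>m. M a b c = of_nat m \<and> p dvd m"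
proof -
  obtain m where m: "M_num a b c = M_den a b c * m"
    using M_den_dvd_M_num by blast
  then have "0 < m" using M_num_pos[of a b c] by (cases m) auto
  (* hence n lies in the range of the exponents e below *)
  have "n < p ^ n" using p by (intro power_gt_expt prime_gt_Suc_0_nat)
  then have "0 < (\<Sum>e=1..a + b + c. defect (p ^ e) a b c)"
    using n q p defect_pos[OF le q]
    by (intro sum_pos2[of _ n] defect_nonneg) (auto simp: prime_gt_0_nat)
  moreover have "multiplicity p (M_num a b c) = multiplicity p (M_den a b c) + multiplicity p m"
    unfolding m using p \<open>0 < m\<close> M_den_pos[of a b c]
    by (intro prime_elem_multiplicity_mult_distrib) auto
  ultimately have "0 < multiplicity p m"
    using multiplicity_M_num_minus_den[OF p, of a b c] by simp
  then have "p dvd m"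
    using not_dvd_imp_multiplicity_0[of p m] by fastforce
  moreover have "M a b c = of_nat m"
    using M_den_pos[of a b c] by (simp add: M_eq_num_div_den m)
  ultimately show ?thesis by blast
qed

theorem theorem4p4:
  shows "(\<forall>a b c p :: nat.
            1 \<le> a \<and> 1 \<le> b \<and> 1 \<le> c \<and> a \<le> b \<and> b \<le> c - 1 \<and> prime p \<and>
            (\<exists>n::nat. n \<ge> 1 \<and> b + c \<le> p ^ n \<and> p ^ n \<le> a + b + c - 1)
            \<longrightarrow> (\<exists>m::nat. M a b c = of_nat m \<and> p dvd m))
       \<and> (\<forall>a b p :: nat.
            1 \<le> a \<and> 1 \<le> b \<and> a \<le> b \<and> prime p \<and>
            (\<exists>n::nat. n \<ge> 1 \<and> 2 * b \<le> p ^ n \<and> p ^ n \<le> a + 2 * b - 2)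
            \<longrightarrow> (\<exists>m::nat. M a b b = of_nat m \<and> p dvd m))"
proof (intro conjI allI impI; elim conjE exE)
  fix a b c p n :: nat
  assume "1 \<le> a" "a \<le> b" "b \<le> c - 1" "prime p" "n \<ge> 1"
    "b + c \<le> p ^ n" "p ^ n \<le> a + b + c - 1"
  then show "\<exists>m::nat. M a b c = of_nat m \<and> p dvd m"
    by (intro prime_dvd_M[where n = n]) auto
next
  fix a b p n :: nat
  assume "1 \<le> a" "a \<le> b" "prime p" "n \<ge> 1"
    "2 * b \<le> p ^ n" "p ^ n \<le> a + 2 * b - 2"
  then show "\<exists>m::nat. M a b b = of_nat m \<and> p dvd m"
    by (intro prime_dvd_M[where n = n]) auto
qed

end
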